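(* Let $n\ge3$ and define the $\mathcal{L}_{\mathrm{B}}$-sentences $$\Psi_\forall:\equiv\forall p_1p_2p_3\,\bigl(\neg\operatorname{Coll}(p_1,p_2,p_3)\to\pi^{\circ}(p_1,p_2,p_3)\bigr),\qquad \Psi_\exists:\equiv\exists p_1p_2p_3\,\bigl(\neg\operatorname{Coll}(p_1,p_2,p_3)\wedge\pi^{\circ}(p_1,p_2,p_3)\bigr),$$ where $\pi^\circ$ is the relativization of the Playfair sentence $\pi$ to the planar section through $p_1,p_2,p_3$. Then $$\mathbb{R}^n\models\Psi_\forall\wedge\Psi_\exists,\qquad\Sigma_n\models\neg\Psi_\forall\wedge\Psi_\exists,\qquad B^n\models\neg\Psi_\forall\wedge\neg\Psi_\exists,$$ where $\Sigma_n=\{x\in\mathbb{R}^n:0<x_n<1\}$ is the open slab and $B^n$ the open unit ball of $\mathbb{R}^n$. Hence $\mathbb{R}^n$, the open slab (equivalently the open half-space, to which it is $\mathcal{L}_{\mathrm{B}}$-isomorphic), and the open ball are pairwise elementarily inequivalent in $\mathcal{L}_{\mathrm{B}}$.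
   Context: $\mathcal{L}_{\mathrm{B}}$ is the first-order language with a single ternary relation symbol $B$. A convex set $K\subseteq\mathbb{R}^n$ is an $\mathcal{L}_{\mathrm{B}}$-structure with universe $K$, where $B(a,x,b)$ holds iff $x\in[a,b]$. $\operatorname{Coll}(x,y,z):\equiv B(x,y,z)\vee B(y,x,z)\vee B(x,z,y)$; $\operatorname{Meets}(a,b;c,d):\equiv\exists z\,(\operatorname{Coll}(a,b,z)\wedge\operatorname{Coll}(c,d,z))$. The Playfair sentence is $$\pi:\ \forall a\,b\,p\,c\,c'\Bigl[\bigl(a\ne b\wedge\neg\operatorname{Coll}(a,b,p)\wedge c\ne p\wedge c'\ne p\wedge\neg\operatorname{Meets}(p,c;a,b)\wedge\neg\operatorname{Meets}(p,c';a,b)\bigr)\to\operatorname{Coll}(p,c,c')\Bigr].$$ $H_1(z;x_1):\equiv z=x_1$, $H_r(z;x_1,\dots,x_r):\equiv\exists w\,(H_{r-1}(w;x_2,\dots,x_r)\wedge B(x_1,z,w))$, and $\operatorname{Dep}_m(x_1,\dots,x_m):\equiv\bigvee_{\{1,\dots,m\}=I\sqcup J,\ I,J\ne\emptyset}\exists z\,(H_{|I|}(z;\bar x_I)\wedge H_{|J|}(z;\bar x_J))$. For a formula $\psi$, $\psi^\circ(\,\cdot\,;p_1,p_2,p_3)$ is obtained by relativizing every quantifier of $\psi$ to $\operatorname{Dep}_4(p_1,p_2,p_3,\cdot)$; for non-collinear $p_1,p_2,p_3\in K$ this formula defines the planar section $K\cap\operatorname{aff}\{p_1,p_2,p_3\}$,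 and $K\models\psi^\circ$ iff the section (as a structure) satisfies $\psi$. *)

theory Defs
  imports "HOL-Analysis.Analysis"
begin

text \<open>First-order formulas over one ternary relation symbol. Variables are de Bruijn indices:
  index \<open>0\<close> is bound by the innermost enclosing quantifier, and the index of every other variable
  is raised by one when a quantifier is crossed.\<close>

datatype form =
    Falsum
  | Eq nat nat
  | Bet nat nat nat
  | Neg form
  | And form form
  | Or form form
  | Imp form form
  | Forall form
  | Exists form

type_synonym 'a bstruct = "'a set \<times> ('a \<Rightarrow> 'a \<Rightarrow> 'a \<Rightarrow> bool)"

primrec sat :: "'a bstruct \<Rightarrow> (nat \<Rightarrow> 'a) \<Rightarrow> form \<Rightarrow> bool" where
  "sat S e Falsum \<longleftrightarrow> False"
| "sat S e (Eq x y) \<longleftrightarrow> e x = e y"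
| "sat S e (Bet x y z) \<longleftrightarrow> snd S (e x) (e y) (e z)"
| "sat S e (Neg \<phi>) \<longleftrightarrow> \<not> sat S e \<phi>"
| "sat S e (And \<phi> \<psi>) \<longleftrightarrow> sat S e \<phi> \<and> sat S e \<psi>"
| "sat S e (Or \<phi> \<psi>) \<longleftrightarrow> sat S e \<phi> \<or> sat S e \<psi>"
| "sat S e (Imp \<phi> \<psi>) \<longleftrightarrow> (sat S e \<phi> \<longrightarrow> sat S e \<psi>)"
| "sat S e (Forall \<phi>) \<longleftrightarrow> (\<forall>a\<in>fst S. sat S (case_nat a e) \<phi>)"
| "sat S e (Exists \<phi>) \<longleftrightarrow> (\<exists>a\<in>fst S. sat S (case_nat a e) \<phi>)"

primrec free_vars :: "form \<Rightarrow> nat set" where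
  "free_vars Falsum = {}"
| "free_vars (Eq x y) = {x, y}"
| "free_vars (Bet x y z) = {x, y, z}"
| "free_vars (Neg \<phi>) = free_vars \<phi>"
| "free_vars (And \<phi> \<psi>) = free_vars \<phi> \<union> free_vars \<psi>"
| "free_vars (Or \<phi> \<psi>) = free_vars \<phi> \<union> free_vars \<psi>"
| "free_vars (Imp \<phi> \<psi>) = free_vars \<phi> \<union> free_vars \<psi>"
| "free_vars (Forall \<phi>) = {i. Suc i \<in> free_vars \<phi>}"
| "free_vars (Exists \<phi>) = {i. Suc i \<in> free_vars \<phi>}"

definition sentence :: "form \<Rightarrow> bool" where
  "sentence \<phi> \<longleftrightarrow> free_vars \<phi> = {}"

definition models :: "'a bstruct \<Rightarrow> form \<Rightarrow> bool"  (infix "\<Turnstile>" 50) where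
  "S \<Turnstile> \<phi> \<longleftrightarrow> (\<forall>e. range e \<subseteq> fst S \<longrightarrow> sat S e \<phi>)"

definition elem_equiv :: "'a bstruct \<Rightarrow> 'b bstruct \<Rightarrow> bool" where
  "elem_equiv S T \<longleftrightarrow> (\<forall>\<phi>. sentence \<phi> \<longrightarrow> (S \<Turnstile> \<phi> \<longleftrightarrow> T \<Turnstile> \<phi>))"

definition isomorphic :: "'a bstruct \<Rightarrow> 'b bstruct \<Rightarrow> bool" where
  "isomorphic S T \<longleftrightarrow> (\<exists>f. bij_betw f (fst S) (fst T) \<and>
     (\<forall>a\<in>fst S. \<forall>x\<in>fst S. \<forall>b\<in>fst S. snd S a x b \<longleftrightarrow> snd T (f a) (f x) (f b)))"

text \<open>The relation is only ever evaluated on elements of the universe \<open>K\<close>.\<close>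

definition convex_struct :: "'a::real_vector set \<Rightarrow> 'a bstruct" where
  "convex_struct K = (K, \<lambda>a x b. x \<in> closed_segment a b)"

definition Coll :: "nat \<Rightarrow> nat \<Rightarrow> nat \<Rightarrow> form" where
  "Coll x y z = Or (Bet x y z) (Or (Bet y x z) (Bet x z y))"

definition Meets :: "nat \<Rightarrow> nat \<Rightarrow> nat \<Rightarrow> nat \<Rightarrow> form" where
  "Meets a b c d = Exists (And (Coll (Suc a) (Suc b) 0) (Coll (Suc c) (Suc d) 0))"

definition playfair :: form where
  "playfair =
    (let a = 4; b = 3; p = 2; c = 1; c' = 0 in
     Forall (Forall (Forall (Forall (Forall
       (Imp
         (And (Neg (Eq a b))
         (And (Neg (Coll a b p))
         (And (Neg (Eq c p))
         (And (Neg (Eq c' p))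
         (And (Neg (Meets p c a b))
              (Neg (Meets p c' a b)))))))
         (Coll p c c')))))))"

text \<open>\<open>H z [x\<^sub>1, \<dots>, x\<^sub>r]\<close> is $H_r(z; x_1, \dots, x_r)$, for \<open>r \<ge> 1\<close>.\<close>

fun H :: "nat \<Rightarrow> nat list \<Rightarrow> form" where
  "H z [] = Falsum"
| "H z [x] = Eq z x"
| "H z (x # y # ys) = Exists (And (H 0 (map Suc (y # ys))) (Bet (Suc x) (Suc z) 0))"

definition Disj :: "form list \<Rightarrow> form" where
  "Disj \<phi>s = foldr Or \<phi>s Falsum"

text \<open>The disjunction runs over the position sets \<open>I\<close> of \<open>xs\<close> that are neither empty nor full;
  \<open>nths xs I\<close> is the subtuple of \<open>xs\<close> at the positions in \<open>I\<close>, in increasing order.\<close>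

definition Dep :: "nat list \<Rightarrow> form" where
  "Dep xs = Disj
     [Exists (And (H 0 (map Suc (nths xs (set I)))) (H 0 (map Suc (nths xs (- set I))))).
        I \<leftarrow> subseqs [0..<length xs], set I \<noteq> {} \<and> set I \<noteq> {0..<length xs}]"

text \<open>The parameters \<open>p\<^sub>1, p\<^sub>2, p\<^sub>3\<close> live in the same context as the free variables of the formula,
  so they are raised together with them under each quantifier.\<close>

primrec relativize :: "nat \<Rightarrow> nat \<Rightarrow> nat \<Rightarrow> form \<Rightarrow> form" where
  "relativize p1 p2 p3 Falsum = Falsum"
| "relativize p1 p2 p3 (Eq x y) = Eq x y"
| "relativize p1 p2 p3 (Bet x y z) = Bet x y z"
| "relativize p1 p2 p3 (Neg \<phi>) = Neg (relativize p1 p2 p3 \<phi>)"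
| "relativize p1 p2 p3 (And \<phi> \<psi>) = And (relativize p1 p2 p3 \<phi>) (relativize p1 p2 p3 \<psi>)"
| "relativize p1 p2 p3 (Or \<phi> \<psi>) = Or (relativize p1 p2 p3 \<phi>) (relativize p1 p2 p3 \<psi>)"
| "relativize p1 p2 p3 (Imp \<phi> \<psi>) = Imp (relativize p1 p2 p3 \<phi>) (relativize p1 p2 p3 \<psi>)"
| "relativize p1 p2 p3 (Forall \<phi>) =
     Forall (Imp (Dep [Suc p1, Suc p2, Suc p3, 0])
                 (relativize (Suc p1) (Suc p2) (Suc p3) \<phi>))"
| "relativize p1 p2 p3 (Exists \<phi>) =
     Exists (And (Dep [Suc p1, Suc p2, Suc p3, 0])
                 (relativize (Suc p1) (Suc p2) (Suc p3) \<phi>))"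

definition Psi_all :: form where
  "Psi_all =
    (let p1 = 2; p2 = 1; p3 = 0 in
     Forall (Forall (Forall (Imp (Neg (Coll p1 p2 p3)) (relativize p1 p2 p3 playfair)))))"

definition Psi_ex :: form where
  "Psi_ex =
    (let p1 = 2; p2 = 1; p3 = 0 in
     Exists (Exists (Exists (And (Neg (Coll p1 p2 p3)) (relativize p1 p2 p3 playfair)))))"

lemma free_vars_H: "free_vars (H z xs) \<subseteq> insert z (set xs)"
  by (induction z xs rule: H.induct) auto

lemma free_vars_Disj: "free_vars (Disj \<phi>s) = (\<Union>\<phi>\<in>set \<phi>s. free_vars \<phi>)"
  by (induction \<phi>s) (auto simp: Disj_def)

lemma free_vars_Dep: "free_vars (Dep xs) \<subseteq> set xs"
proof -
  have "i \<in> set xs" if "Suc i \<in> free_vars (H 0 (map Suc (nths xs I)))" for i I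
    using that free_vars_H[of 0 "map Suc (nths xs I)"] set_nths_subset[of xs I] by auto
  then show ?thesis
    by (auto simp: Dep_def free_vars_Disj)
qed

lemma free_vars_relativize: "free_vars (relativize p1 p2 p3 \<phi>) \<subseteq> free_vars \<phi> \<union> {p1, p2, p3}"
proof (induction \<phi> arbitrary: p1 p2 p3)
  case (Forall \<phi>)
  from Forall[of "Suc p1" "Suc p2" "Suc p3"] free_vars_Dep[of "[Suc p1, Suc p2, Suc p3, 0]"]
  show ?case by auto
next
  case (Exists \<phi>)
  from Exists[of "Suc p1" "Suc p2" "Suc p3"] free_vars_Dep[of "[Suc p1, Suc p2, Suc p3, 0]"]
  show ?case by auto
qed (simp; blast)+

lemma sentence_playfair: "sentence playfair"
  by (simp add: sentence_def playfair_def Coll_def Meets_def Let_def)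

lemma sentence_Psi: "sentence Psi_all" "sentence Psi_ex"
  using free_vars_relativize[of 2 1 0 playfair] sentence_playfair
  by (auto simp: sentence_def Psi_all_def Psi_ex_def Coll_def Let_def)

definition open_slab :: "'n::finite \<Rightarrow> (real ^ 'n) set" where
  "open_slab k = {x. 0 < x $ k \<and> x $ k < 1}"

definition open_halfspace :: "'n::finite \<Rightarrow> (real ^ 'n) set" where
  "open_halfspace k = {x. 0 < x $ k}"

end

theory Submission
  imports Defs
begin

text \<open>By Radon's theorem \<open>Dep\<close> expresses affine dependence of a tuple inside a convex set, so for
  non-collinear parameters the relativized Playfair sentence speaks about the planar section
  through them. The Playfair property holds in a section that is a whole affine plane. It fails in
  the section of an open set \<open>K\<close> as soon as two points of the section span a line that leaves \<open>K\<close>.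
  In the whole space every planar section is a plane; the slab has both kinds of sections (parallel
  and orthogonal to its boundary); in the ball no line is complete.\<close>

section \<open>Isomorphic structures\<close>

lemma range_case_nat: "range (case_nat a e) = insert a (range e)"
  by (subst UNIV_nat_eq) (simp add: image_image)

text \<open>Induction on formulas with the environment generalized. Injectivity of \<open>f\<close>
  settles equations, and surjectivity lets a quantifier over \<open>fst S\<close> be read as one
  over \<open>fst T\<close>. Environments stay inside the universe because \<open>f\<close> is
  controlled only there.\<close>

lemma sat_isomorphism:
  assumes bij: "bij_betw f (fst S) (fst T)"
    and pres: "\<And>a x b. a \<in> fst S \<Longrightarrow> x \<in> fst S \<Longrightarrow> b \<in> fst S \<Longrightarrow>
                 snd S a x b \<longleftrightarrow> snd T (f a) (f x) (f b)"
    and "range e \<subseteq> fst S"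
  shows "sat S e \<phi> \<longleftrightarrow> sat T (f \<circ> e) \<phi>"
  using assms(3)
proof (induction \<phi> arbitrary: e)
  case (Eq x y)
  then show ?case
    using bij by (auto simp: bij_betw_def image_subset_iff inj_on_eq_iff)
next
  case (Bet x y z)
  then show ?case
    using pres[of "e x" "e y" "e z"] by auto
next
  case (Forall \<phi>)
  have "sat S (case_nat a e) \<phi> \<longleftrightarrow> sat T (case_nat (f a) (f \<circ> e)) \<phi>" if "a \<in> fst S" for a
  proof -
    have "range (case_nat a e) \<subseteq> fst S"
      using Forall.prems that by (simp add: range_case_nat)
    moreover have "f \<circ> case_nat a e = case_nat (f a) (f \<circ> e)"
      by (auto split: nat.splits)
    ultimately show ?thesis
      using Forall.IH[of "case_nat a e"] by simp
  qed
  then have "sat S e (Forall \<phi>) \<longleftrightarrow> (\<forall>a\<in>fst S. sat T (case_nat (f a) (f \<circ> e)) \<phi>)"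
    by simp
  also have "\<dots> \<longleftrightarrow> (\<forall>b\<in>fst T. sat T (case_nat b (f \<circ> e)) \<phi>)"
    using bij_betw_imp_surj_on[OF bij, symmetric] by simp
  finally show ?case by (simp add: comp_def)
next
  case (Exists \<phi>)
  have "sat S (case_nat a e) \<phi> \<longleftrightarrow> sat T (case_nat (f a) (f \<circ> e)) \<phi>" if "a \<in> fst S" for a
  proof -
    have "range (case_nat a e) \<subseteq> fst S"
      using Exists.prems that by (simp add: range_case_nat)
    moreover have "f \<circ> case_nat a e = case_nat (f a) (f \<circ> e)"
      by (auto split: nat.splits)
    ultimately show ?thesis
      using Exists.IH[of "case_nat a e"] by simp
  qed
  then have "sat S e (Exists \<phi>) \<longleftrightarrow> (\<exists>a\<in>fst S. sat T (case_nat (f a) (f \<circ> e)) \<phi>)"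
    by simp
  also have "\<dots> \<longleftrightarrow> (\<exists>b\<in>fst T. sat T (case_nat b (f \<circ> e)) \<phi>)"
    using bij_betw_imp_surj_on[OF bij, symmetric] by simp
  finally show ?case by (simp add: comp_def)
qed auto

lemma isomorphic_imp_models_iff:
  fixes S :: "'a bstruct" and T :: "'b bstruct"
  assumes "isomorphic S T"
  shows "S \<Turnstile> \<phi> \<longleftrightarrow> T \<Turnstile> \<phi>"
proof -
  obtain f where bij: "bij_betw f (fst S) (fst T)"
    and pres: "\<forall>a\<in>fst S. \<forall>x\<in>fst S. \<forall>b\<in>fst S. snd S a x b \<longleftrightarrow> snd T (f a) (f x) (f b)"
    using assms by (auto simp: isomorphic_def)
  have iff: "sat S e \<phi> \<longleftrightarrow> sat T (f \<circ> e) \<phi>" if "range e \<subseteq> fst S" for e :: "nat \<Rightarrow> 'a"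
    using sat_isomorphism[OF bij _ that] pres by blast
  show ?thesis
  proof
    assume S: "S \<Turnstile> \<phi>"
    show "T \<Turnstile> \<phi>"
      unfolding models_def
    proof (intro allI impI)
      fix e :: "nat \<Rightarrow> 'b" assume e: "range e \<subseteq> fst T"
      \<comment> \<open>Environments of \<open>T\<close> are pulled back along the inverse of
        \<open>f\<close>, so that every one of them has the form \<open>f \<circ> d\<close>.\<close>
      define d where "d = inv_into (fst S) f \<circ> e"
      have "range d \<subseteq> fst S"
        using e bij_betw_inv_into[OF bij] by (auto simp: d_def bij_betw_def)
      moreover have "f \<circ> d = e"
        using e bij by (auto simp: d_def fun_eq_iff image_subset_iff bij_betw_inv_into_right)
      ultimately show "sat T e \<phi>"
        using iff[of d] S by (auto simp: models_def)
    qed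
  next
    assume T: "T \<Turnstile> \<phi>"
    show "S \<Turnstile> \<phi>"
      unfolding models_def
    proof (intro allI impI)
      fix e :: "nat \<Rightarrow> 'a" assume e: "range e \<subseteq> fst S"
      then have "range (f \<circ> e) \<subseteq> fst T"
        using bij by (auto simp: bij_betw_def)
      then show "sat S e \<phi>"
        using iff[OF e] T by (auto simp: models_def)
    qed
  qed
qed

text \<open>Over an empty universe there are no environments and \<open>\<Turnstile>\<close> holds
  vacuously, even for a formula and its negation. A point of \<open>T\<close> supplies a constant
  environment that refutes \<open>\<phi>\<close>.\<close>

lemma not_elem_equivI:
  assumes "sentence \<phi>" "S \<Turnstile> \<phi>" "T \<Turnstile> Neg \<phi>" "fst T \<noteq> {}"
  shows "\<not> elem_equiv S T"
proof -
  obtain x where "x \<in> fst T"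
    using assms(4) by blast
  then have "\<not> T \<Turnstile> \<phi>"
    using assms(3) by (auto simp: models_def intro!: exI[of _ "\<lambda>_. x"])
  then show ?thesis
    using assms(1,2) by (auto simp: elem_equiv_def)
qed

section \<open>Semantics of the defined formulas in convex sets\<close>

lemma fst_convex_struct: "fst (convex_struct K) = K"
  by (simp add: convex_struct_def)

lemma sat_Coll:
  fixes K :: "'a::euclidean_space set"
  shows "sat (convex_struct K) e (Coll x y z) \<longleftrightarrow> collinear {e x, e y, e z}"
  by (auto simp: Coll_def convex_struct_def collinear_between_cases between_mem_segment
      closed_segment_commute)

text \<open>The hull of a nonempty list is the union of the segments from its head to points of the
  hull of its tail, which is the recursion of \<open>H\<close>. Convexity of \<open>K\<close> keeps
  these intermediate points \<open>w\<close> in the universe.\<close>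

lemma sat_H:
  assumes "convex K" "xs \<noteq> []" "e z \<in> K" "e ` set xs \<subseteq> K"
  shows "sat (convex_struct K) e (H z xs) \<longleftrightarrow> e z \<in> convex hull (e ` set xs)"
  using assms(2-)
proof (induction z xs arbitrary: e rule: H.induct)
  case (3 z x y ys)
  let ?Y = "e ` set (y # ys)"
  have hull: "convex hull ?Y \<subseteq> K"
    using 3(4) assms(1) by (intro hull_minimal) auto
  have "sat (convex_struct K) (case_nat w e) (H 0 (map Suc (y # ys))) \<longleftrightarrow> w \<in> convex hull ?Y"
    if "w \<in> K" for w
    using 3(1)[of "case_nat w e"] 3(4) that by (simp add: image_image)
  then have "sat (convex_struct K) e (H z (x # y # ys)) \<longleftrightarrow>
      (\<exists>w\<in>K. w \<in> convex hull ?Y \<and> e z \<in> closed_segment (e x) w)"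
    by (auto simp: convex_struct_def)
  also have "\<dots> \<longleftrightarrow> (\<exists>w\<in>convex hull ?Y. e z \<in> closed_segment (e x) w)"
    using hull by blast
  also have "\<dots> \<longleftrightarrow> e z \<in> convex hull (insert (e x) ?Y)"
    by (subst convex_hull_insert_segments) simp
  finally show ?case by simp
qed auto

lemma sat_Disj: "sat S e (Disj \<phi>s) \<longleftrightarrow> (\<exists>\<phi>\<in>set \<phi>s. sat S e \<phi>)"
  by (induction \<phi>s) (auto simp: Disj_def)

section \<open>Radon partitions and the formula \<open>Dep\<close>\<close>

text \<open>Radon's theorem for indexed families, since \<open>Dep\<close> splits positions rather
  than values. Disjoint subsets of an affinely independent set have disjoint hulls. Conversely, a
  repeated value is separated from its copy by a singleton \<open>{i}\<close>, and without
  repetitions the usual Radon partition pulls back to the indices.\<close>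

lemma Radon_family_iff:
  fixes v :: "'i \<Rightarrow> 'a::euclidean_space"
  assumes "finite I"
  shows "(\<exists>A. A \<noteq> {} \<and> A \<subset> I \<and> convex hull (v ` A) \<inter> convex hull (v ` (I - A)) \<noteq> {}) \<longleftrightarrow>
         \<not> inj_on v I \<or> affine_dependent (v ` I)"
proof
  assume "\<exists>A. A \<noteq> {} \<and> A \<subset> I \<and> convex hull (v ` A) \<inter> convex hull (v ` (I - A)) \<noteq> {}"
  then obtain A where A: "A \<subset> I" "convex hull (v ` A) \<inter> convex hull (v ` (I - A)) \<noteq> {}"
    by blast
  show "\<not> inj_on v I \<or> affine_dependent (v ` I)"
  proof (rule ccontr)
    assume "\<not> ?thesis"
    then have inj: "inj_on v I" and ind: "\<not> affine_dependent (v ` I)" by auto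
    have "v ` A \<union> v ` (I - A) = v ` I"
      using A(1) by blast
    then have "convex hull (v ` A) \<inter> convex hull (v ` (I - A)) =
        convex hull (v ` A \<inter> v ` (I - A))"
      using ind by (simp add: convex_hull_Int)
    also have "v ` A \<inter> v ` (I - A) = {}"
      using inj A(1) by (auto dest: inj_onD)
    finally show False
      using A(2) by simp
  qed
next
  assume dep: "\<not> inj_on v I \<or> affine_dependent (v ` I)"
  show "\<exists>A. A \<noteq> {} \<and> A \<subset> I \<and> convex hull (v ` A) \<inter> convex hull (v ` (I - A)) \<noteq> {}"
  proof (cases "inj_on v I")
    case False
    then obtain i j where ij: "i \<in> I" "j \<in> I" "i \<noteq> j" "v i = v j"
      by (auto simp: inj_on_def)
    then have "v i \<in> convex hull (v ` {i}) \<inter> convex hull (v ` (I - {i}))"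
      by (auto intro!: hull_inc)
    then show ?thesis
      using ij by (intro exI[of _ "{i}"]) auto
  next
    case True
    with dep have "affine_dependent (v ` I)" by simp
    then obtain M P where MP: "M \<inter> P = {}" "M \<union> P = v ` I" "convex hull M \<inter> convex hull P \<noteq> {}"
      using Radon_partition[of "v ` I"] assms by auto
    have "M \<noteq> {}" "P \<noteq> {}"
      using MP(3) by auto
    define A where "A = {i \<in> I. v i \<in> M}"
    have "v ` A = M" "v ` (I - A) = P"
      using MP(1,2) by (auto simp: A_def) blast+
    then show ?thesis
      using MP(3) \<open>M \<noteq> {}\<close> \<open>P \<noteq> {}\<close> by (intro exI[of _ A]) (auto simp: A_def)
  qed
qed

text \<open>The common point of two hulls is quantified over \<open>K\<close> only, but by convexity
  both hulls lie in \<open>K\<close>, so nothing is lost and the indexed Radon theorem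
  applies.\<close>

lemma sat_Dep:
  fixes K :: "'a::euclidean_space set"
  assumes "convex K" "e ` set xs \<subseteq> K"
  shows "sat (convex_struct K) e (Dep xs) \<longleftrightarrow>
         \<not> inj_on (\<lambda>i. e (xs ! i)) {0..<length xs} \<or> affine_dependent (e ` set xs)"
proof -
  let ?n = "{0..<length xs}" and ?v = "\<lambda>i. e (xs ! i)"
  have set_nths': "e ` set (nths xs A) = ?v ` (?n \<inter> A)" for A
  proof -
    have "set (nths xs A) = (!) xs ` (?n \<inter> A)"
      by (auto simp: set_nths)
    then show ?thesis
      by (simp add: image_image)
  qed
  have sat_part: "sat (convex_struct K) e
        (Exists (And (H 0 (map Suc (nths xs A))) (H 0 (map Suc (nths xs (- A)))))) \<longleftrightarrow>
      convex hull (?v ` A) \<inter> convex hull (?v ` (?n - A)) \<noteq> {}"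
    if A: "A \<noteq> {}" "A \<subset> ?n" for A
  proof -
    have sat_half: "sat (convex_struct K) (case_nat w e) (H 0 (map Suc (nths xs B))) \<longleftrightarrow>
        w \<in> convex hull (?v ` (?n \<inter> B))"
      if "w \<in> K" "?n \<inter> B \<noteq> {}" for w B
    proof -
      have "nths xs B \<noteq> []"
        using that(2) set_nths'[of B] by auto
      moreover have "e ` set (nths xs B) \<subseteq> K"
        using assms(2) set_nths_subset[of xs B] by blast
      ultimately show ?thesis
        using sat_H[OF assms(1), of "map Suc (nths xs B)" "case_nat w e" 0] that(1)
        by (simp add: image_image flip: set_nths')
    qed
    \<comment> \<open>\<open>Dep\<close> selects the second block by the complement of
      \<open>A\<close> in all natural numbers; only its trace on the valid positions
      matters.\<close>
    have "?n \<inter> A = A" "?n \<inter> - A = ?n - A" "?n - A \<noteq> {}"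
      using A by auto
    moreover have "convex hull (?v ` A) \<subseteq> K"
      using A assms by (intro hull_minimal) (auto simp: image_subset_iff)
    ultimately show ?thesis
      using sat_half[of _ A] sat_half[of _ "- A"] A(1) by (auto simp: convex_struct_def)
  qed
  have "sat (convex_struct K) e (Dep xs) \<longleftrightarrow>
      (\<exists>A\<in>set ` set (subseqs [0..<length xs]). A \<noteq> {} \<and> A \<noteq> ?n \<and>
        sat (convex_struct K) e
          (Exists (And (H 0 (map Suc (nths xs A))) (H 0 (map Suc (nths xs (- A)))))))"
    by (auto simp: Dep_def sat_Disj simp del: sat.simps)
  also have "\<dots> \<longleftrightarrow> (\<exists>A. A \<noteq> {} \<and> A \<subset> ?n \<and>
        sat (convex_struct K) e
          (Exists (And (H 0 (map Suc (nths xs A))) (H 0 (map Suc (nths xs (- A)))))))"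
    unfolding subseqs_powset by (auto simp del: sat.simps)
  also have "\<dots> \<longleftrightarrow>
      (\<exists>A. A \<noteq> {} \<and> A \<subset> ?n \<and> convex hull (?v ` A) \<inter> convex hull (?v ` (?n - A)) \<noteq> {})"
    by (intro ex_cong1 conj_cong refl sat_part)
  also have "\<dots> \<longleftrightarrow> \<not> inj_on ?v ?n \<or> affine_dependent (?v ` ?n)"
    by (rule Radon_family_iff) simp
  also have "?v ` ?n = e ` set xs"
    using set_nths'[of UNIV] by (simp add: nths_all)
  finally show ?thesis .
qed

text \<open>The three parameters are distinct and affinely independent, so a repetition or a
  dependence among the four points must involve \<open>e x\<close>: it equals a parameter or lies in
  their plane.\<close>

lemma sat_Dep_section:
  fixes K :: "'a::euclidean_space set"
  assumes "convex K" "range e \<subseteq> K" "\<not> collinear {e p1, e p2, e p3}"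
  shows "sat (convex_struct K) e (Dep [p1, p2, p3, x]) \<longleftrightarrow> e x \<in> affine hull {e p1, e p2, e p3}"
proof -
  let ?P = "{e p1, e p2, e p3}"
  have ind: "e p1 \<noteq> e p2" "e p1 \<noteq> e p3" "e p2 \<noteq> e p3" "\<not> affine_dependent ?P"
    using assms(3) by (auto simp: collinear_3_eq_affine_dependent)
  have inj: "inj_on (\<lambda>i. e ([p1, p2, p3, x] ! i)) {0..<length [p1, p2, p3, x]} \<longleftrightarrow> e x \<notin> ?P"
    using ind by (simp add: inj_on_def atLeast0_lessThan_Suc numeral_eq_Suc) metis
  have "sat (convex_struct K) e (Dep [p1, p2, p3, x]) \<longleftrightarrow>
      e x \<in> ?P \<or> affine_dependent (insert (e x) ?P)"
    using sat_Dep[OF assms(1), of e "[p1, p2, p3, x]"] assms(2) inj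
    by (auto simp: insert_commute)
  also have "\<dots> \<longleftrightarrow> e x \<in> affine hull ?P"
  proof (cases "e x \<in> ?P")
    case True
    then show ?thesis by (auto intro: hull_inc)
  next
    case False
    then have "insert (e x) ?P - {e x} = ?P" by auto
    then have "affine_dependent (insert (e x) ?P)" if "e x \<in> affine hull ?P"
      using that unfolding affine_dependent_def by (metis insertI1)
    then show ?thesis
      using False affine_independent_insert[OF ind(4)] by blast
  qed
  finally show ?thesis .
qed

section \<open>Relativization to planar sections\<close>

text \<open>Betweenness is the same relation in \<open>K\<close> and in the section, so only
  quantifiers differ, and \<open>Dep\<close> guards exactly these. The environment may leave the
  section; this must be allowed because free variables are arbitrary points of \<open>K\<close>.
  Raising the indices along with the environment keeps the same plane.\<close>

lemma sat_relativize:
  fixes K :: "'a::euclidean_space set"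
  assumes "convex K" "range e \<subseteq> K" "\<not> collinear {e p1, e p2, e p3}"
  shows "sat (convex_struct K) e (relativize p1 p2 p3 \<phi>) \<longleftrightarrow>
         sat (convex_struct (K \<inter> affine hull {e p1, e p2, e p3})) e \<phi>"
  using assms(2,3)
proof (induction \<phi> arbitrary: e p1 p2 p3)
  case (Forall \<phi>)
  have "range (case_nat a e) \<subseteq> K" if "a \<in> K" for a
    using Forall.prems that by (simp add: range_case_nat)
  then show ?case
    using Forall.IH[of "case_nat _ e" "Suc p1" "Suc p2" "Suc p3"] Forall.prems
      sat_Dep_section[OF assms(1), of "case_nat _ e" "Suc p1" "Suc p2" "Suc p3" 0]
    by (auto simp: convex_struct_def)
next
  case (Exists \<phi>)
  have "range (case_nat a e) \<subseteq> K" if "a \<in> K" for a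
    using Exists.prems that by (simp add: range_case_nat)
  then show ?case
    using Exists.IH[of "case_nat _ e" "Suc p1" "Suc p2" "Suc p3"] Exists.prems
      sat_Dep_section[OF assms(1), of "case_nat _ e" "Suc p1" "Suc p2" "Suc p3" 0]
    by (auto simp: convex_struct_def)
qed (auto simp: convex_struct_def)

text \<open>Meeting points must belong to \<open>D\<close>; lines that cross only outside
  \<open>D\<close> count as disjoint, and this is how the property can fail.\<close>

definition Playfair :: "'a::euclidean_space set \<Rightarrow> bool" where
  "Playfair D \<longleftrightarrow> (\<forall>a\<in>D. \<forall>b\<in>D. \<forall>p\<in>D. \<forall>c\<in>D. \<forall>c'\<in>D.
     a \<noteq> b \<and> \<not> collinear {a, b, p} \<and> c \<noteq> p \<and> c' \<noteq> p \<and>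
     \<not> (\<exists>z\<in>D. collinear {p, c, z} \<and> collinear {a, b, z}) \<and>
     \<not> (\<exists>z\<in>D. collinear {p, c', z} \<and> collinear {a, b, z}) \<longrightarrow>
     collinear {p, c, c'})"

lemma sat_playfair: "sat (convex_struct D) e playfair \<longleftrightarrow> Playfair D"
  unfolding playfair_def Playfair_def Meets_def Let_def
  by (simp add: sat_Coll numeral_eq_Suc del: One_nat_def)
     (simp add: convex_struct_def)

lemma sat_relativize_playfair:
  assumes "convex K" "range e \<subseteq> K" "p1 \<in> K" "p2 \<in> K" "p3 \<in> K" "\<not> collinear {p1, p2, p3}"
  shows "sat (convex_struct K) (case_nat p3 (case_nat p2 (case_nat p1 e)))
           (relativize 2 (Suc 0) 0 playfair) \<longleftrightarrow> Playfair (K \<inter> affine hull {p1, p2, p3})"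
  using sat_relativize[OF assms(1), of "case_nat p3 (case_nat p2 (case_nat p1 e))" 2 "Suc 0" 0 playfair]
    assms(2-) by (simp add: range_case_nat sat_playfair numeral_2_eq_2)

lemma sat_Psi_all:
  assumes "convex K" "range e \<subseteq> K"
  shows "sat (convex_struct K) e Psi_all \<longleftrightarrow>
    (\<forall>p1\<in>K. \<forall>p2\<in>K. \<forall>p3\<in>K. \<not> collinear {p1, p2, p3} \<longrightarrow>
       Playfair (K \<inter> affine hull {p1, p2, p3}))"
  using sat_relativize_playfair[OF assms]
  by (auto simp: Psi_all_def sat_Coll Let_def fst_convex_struct numeral_2_eq_2)

lemma sat_Psi_ex:
  assumes "convex K" "range e \<subseteq> K"
  shows "sat (convex_struct K) e Psi_ex \<longleftrightarrow>
    (\<exists>p1\<in>K. \<exists>p2\<in>K. \<exists>p3\<in>K. \<not> collinear {p1, p2, p3} \<and>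
       Playfair (K \<inter> affine hull {p1, p2, p3}))"
  using sat_relativize_playfair[OF assms]
  by (simp add: Psi_ex_def sat_Coll Let_def fst_convex_struct numeral_2_eq_2 cong: conj_cong bex_cong)

section \<open>The Playfair property of planar sections\<close>

lemma in_affine_hull_2_iff:
  "x \<in> affine hull {a, b} \<longleftrightarrow> (\<exists>t. x = a + t *\<^sub>R (b - a))"
proof
  assume "x \<in> affine hull {a, b}"
  then obtain u t where "x = u *\<^sub>R a + t *\<^sub>R b" "u + t = 1"
    by (auto simp: affine_hull_2)
  moreover from this have "u = 1 - t" by simp
  ultimately have "x = a + t *\<^sub>R (b - a)"
    by (simp add: algebra_simps)
  then show "\<exists>t. x = a + t *\<^sub>R (b - a)" ..
next
  assume "\<exists>t. x = a + t *\<^sub>R (b - a)"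
  then obtain t where "x = (1 - t) *\<^sub>R a + t *\<^sub>R b"
    by (auto simp: algebra_simps)
  moreover have "(1 - t) + t = 1" by simp
  ultimately show "x \<in> affine hull {a, b}"
    unfolding affine_hull_2 by blast
qed

lemma in_affine_hull_3_iff:
  "x \<in> affine hull {a, b, p} \<longleftrightarrow> (\<exists>s t. x = a + s *\<^sub>R (b - a) + t *\<^sub>R (p - a))"
proof
  assume "x \<in> affine hull {a, b, p}"
  then obtain u s t where "x = u *\<^sub>R a + s *\<^sub>R b + t *\<^sub>R p" "u + s + t = 1"
    by (auto simp: affine_hull_3)
  moreover from this have "u = 1 - s - t" by simp
  ultimately have "x = a + s *\<^sub>R (b - a) + t *\<^sub>R (p - a)"
    by (simp add: algebra_simps)
  then show "\<exists>s t. x = a + s *\<^sub>R (b - a) + t *\<^sub>R (p - a)" by blast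
next
  assume "\<exists>s t. x = a + s *\<^sub>R (b - a) + t *\<^sub>R (p - a)"
  then obtain s t where "x = (1 - s - t) *\<^sub>R a + s *\<^sub>R b + t *\<^sub>R p"
    by (auto simp: algebra_simps)
  moreover have "(1 - s - t) + s + t = 1" by simp
  ultimately show "x \<in> affine hull {a, b, p}"
    unfolding affine_hull_3 by blast
qed

text \<open>A noncollinear triple has affine dimension at least 2 and any triple at most 2, so the
  included hull is the whole one.\<close>

lemma affine_hull_noncollinear_eq:
  fixes a b p :: "'a::euclidean_space"
  assumes "{a, b, p} \<subseteq> affine hull {q1, q2, q3}" "\<not> collinear {a, b, p}"
  shows "affine hull {a, b, p} = affine hull {q1, q2, q3}"
proof (rule affine_dim_equal)
  have "aff_dim {q1, q2, q3} \<le> 2"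
    using aff_dim_le_card[of "{q1, q2, q3}"] card_length[of "[q1, q2, q3]"] by simp
  moreover have "aff_dim {a, b, p} \<ge> 2"
    using assms(2) by (simp add: collinear_aff_dim)
  moreover have "aff_dim {a, b, p} \<le> aff_dim {q1, q2, q3}"
    using aff_dim_subset[OF assms(1)] by simp
  ultimately show "aff_dim (affine hull {a, b, p}) = aff_dim (affine hull {q1, q2, q3})"
    by simp
qed (use hull_minimal[OF assms(1)] in auto)

text \<open>Use \<open>a\<close>, \<open>b\<close>, \<open>p\<close> as an affine frame of the
  plane. A point \<open>d\<close> whose line through \<open>p\<close> misses the line through
  \<open>a\<close> and \<open>b\<close> must differ from \<open>p\<close> by a multiple of
  \<open>b - a\<close>, so \<open>c\<close> and \<open>c'\<close> lie on the same parallel.\<close>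

lemma Playfair_affine_plane:
  fixes q1 q2 q3 :: "'a::euclidean_space"
  shows "Playfair (affine hull {q1, q2, q3})"
  unfolding Playfair_def
proof (intro ballI impI, elim conjE)
  let ?D = "affine hull {q1, q2, q3}"
  fix a b p c c'
  assume D: "a \<in> ?D" "b \<in> ?D" "p \<in> ?D" "c \<in> ?D" "c' \<in> ?D"
    and nc: "\<not> collinear {a, b, p}"
    and nm: "\<not> (\<exists>z\<in>?D. collinear {p, c, z} \<and> collinear {a, b, z})"
      "\<not> (\<exists>z\<in>?D. collinear {p, c', z} \<and> collinear {a, b, z})"
    and neq: "a \<noteq> b" "c \<noteq> p" "c' \<noteq> p"
  have plane: "affine hull {a, b, p} = ?D"
    using D nc by (intro affine_hull_noncollinear_eq) auto
  have parallel: "\<exists>s. d = p + s *\<^sub>R (b - a)"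
    if d: "d \<in> ?D" "d \<noteq> p" "\<not> (\<exists>z\<in>?D. collinear {p, d, z} \<and> collinear {a, b, z})" for d
  proof -
    obtain s t where st: "d = a + s *\<^sub>R (b - a) + t *\<^sub>R (p - a)"
      using d(1) unfolding plane[symmetric] in_affine_hull_3_iff by blast
    have "t = 1"
    proof (rule ccontr)
      assume t: "t \<noteq> 1"
      \<comment> \<open>If the \<open>p\<close>-coordinate \<open>t\<close> is not 1, solving
        \<open>d = (1 - t) z + t p\<close> for \<open>z\<close> gives the point where the line
        through \<open>p\<close> and \<open>d\<close> crosses the line through \<open>a\<close> and
        \<open>b\<close>.\<close>
      define r where "r = s / (1 - t)"
      define z where "z = a + r *\<^sub>R (b - a)"
      have s: "s = (1 - t) * r"
        using t by (simp add: r_def)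
      have "d - p = (1 - t) *\<^sub>R (z - p)"
        unfolding z_def st s by (simp add: algebra_simps)
      then have z: "z = p + (1 / (1 - t)) *\<^sub>R (d - p)"
        using t by simp
      have "collinear {a, b, z}"
        using z_def neq(1) by (subst collinear_3_affine_hull) (auto simp: in_affine_hull_2_iff)
      moreover have "collinear {p, d, z}"
        using z d(2) by (subst collinear_3_affine_hull) (auto simp: in_affine_hull_2_iff)
      moreover have "z \<in> ?D"
        unfolding plane[symmetric] in_affine_hull_3_iff using z_def by (metis add.right_neutral scaleR_zero_left)
      ultimately show False
        using d(3) by blast
    qed
    then show ?thesis
      using st by (intro exI[of _ s]) (simp add: algebra_simps)
  qed
  obtain s s' where s: "c = p + s *\<^sub>R (b - a)" "c' = p + s' *\<^sub>R (b - a)"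
    using parallel[of c] parallel[of c'] D nm neq by blast
  then have "s \<noteq> 0"
    using neq by auto
  then have "c' = p + (s' / s) *\<^sub>R (c - p)"
    using s by simp
  then show "collinear {p, c, c'}"
    using neq by (subst collinear_3_affine_hull) (auto simp: in_affine_hull_2_iff)
qed

text \<open>If the point \<open>q\<close> of the line through \<open>a\<close> and \<open>b\<close> is missing from \<open>K\<close>, then the line through
  \<open>p\<close> and \<open>q\<close> is a second line through \<open>p\<close> that does not meet it inside \<open>K\<close>, besides the parallel.\<close>

lemma not_Playfair_section:
  fixes K :: "'a::euclidean_space set"
  assumes "open K" "a \<in> K" "b \<in> K" "p \<in> K" and nc: "\<not> collinear {a, b, p}"
    and line: "\<not> affine hull {a, b} \<subseteq> K"
  shows "\<not> Playfair (K \<inter> affine hull {a, b, p})"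
proof
  assume PF: "Playfair (K \<inter> affine hull {a, b, p})"
  have neq: "a \<noteq> b"
    using nc by auto
  have p: "p \<notin> affine hull {a, b}"
    using nc collinear_3_affine_hull[OF neq, of p] by simp
  obtain q where q: "q \<in> affine hull {a, b}" "q \<notin> K"
    using line by blast
  then obtain r where r: "q = a + r *\<^sub>R (b - a)"
    by (auto simp: in_affine_hull_2_iff)
  have qp: "q \<noteq> p"
    using q(1) p by blast
  \<comment> \<open>By openness, a short enough step from \<open>p\<close> in any direction stays in
    \<open>K\<close>.\<close>
  have near: "\<exists>\<delta>>0. p + \<delta> *\<^sub>R v \<in> K" for v
  proof -
    have "((\<lambda>\<delta>. p + \<delta> *\<^sub>R v) \<longlongrightarrow> p + 0 *\<^sub>R v) (at_right (0::real))"
      by (intro tendsto_intros)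
    then have "\<forall>\<^sub>F \<delta> in at_right (0::real). p + \<delta> *\<^sub>R v \<in> K"
      using assms(1,4) by (intro topological_tendstoD) auto
    then have "\<forall>\<^sub>F \<delta> in at_right (0::real). 0 < \<delta> \<and> p + \<delta> *\<^sub>R v \<in> K"
      using eventually_at_right_less[of "0::real"] by eventually_elim simp
    then show ?thesis
      by (rule eventually_happens'[rotated]) simp
  qed
  obtain \<delta> where \<delta>: "\<delta> > 0" "p + \<delta> *\<^sub>R (q - p) \<in> K"
    using near by blast
  obtain \<epsilon> where \<epsilon>: "\<epsilon> > 0" "p + \<epsilon> *\<^sub>R (b - a) \<in> K"
    using near by blast
  define c where "c = p + \<delta> *\<^sub>R (q - p)"
  define c' where "c' = p + \<epsilon> *\<^sub>R (b - a)"
  have cp: "c \<noteq> p" "c' \<noteq> p"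
    using \<delta> \<epsilon> qp neq by (auto simp: c_def c'_def)
  have "c = a + (\<delta> * r) *\<^sub>R (b - a) + (1 - \<delta>) *\<^sub>R (p - a)"
    by (simp add: c_def r algebra_simps)
  then have c: "c \<in> K \<inter> affine hull {a, b, p}"
    using \<delta> unfolding Int_iff in_affine_hull_3_iff c_def[symmetric] by blast
  have "c' = a + \<epsilon> *\<^sub>R (b - a) + 1 *\<^sub>R (p - a)"
    by (simp add: c'_def algebra_simps)
  then have c': "c' \<in> K \<inter> affine hull {a, b, p}"
    using \<epsilon> unfolding Int_iff in_affine_hull_3_iff c'_def[symmetric] by blast
  have meet: "\<not> (collinear {p, c, z} \<and> collinear {a, b, z})" if "z \<in> K" for z
  proof
    assume "collinear {p, c, z} \<and> collinear {a, b, z}"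
    then obtain u t where "z = p + u *\<^sub>R (c - p)" and t: "z = a + t *\<^sub>R (b - a)"
      using collinear_3_affine_hull[of p c z] collinear_3_affine_hull[of a b z] cp neq
      unfolding in_affine_hull_2_iff by metis
    then have z: "z = p + (u * \<delta>) *\<^sub>R (q - p)"
      by (simp add: c_def)
    \<comment> \<open>Parameter of \<open>z\<close> on the line from \<open>p\<close> to
      \<open>q\<close>. The value 1 would make \<open>z\<close> the missing point \<open>q\<close>;
      for any other value, equating the two expressions for \<open>z\<close> puts \<open>p\<close>
      on the line through \<open>a\<close> and \<open>b\<close>.\<close>
    define w where "w = u * \<delta>"
    have w: "w \<noteq> 1"
      using z that q(2) by (auto simp: w_def)
    have "(1 - w) *\<^sub>R p = (1 - w) *\<^sub>R a + (t - w * r) *\<^sub>R (b - a)"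
      using z t unfolding w_def[symmetric] r by (simp add: algebra_simps)
    also have "\<dots> = (1 - w) *\<^sub>R (a + ((t - w * r) / (1 - w)) *\<^sub>R (b - a))"
      using w by (simp add: scaleR_add_right)
    finally have "p = a + ((t - w * r) / (1 - w)) *\<^sub>R (b - a)"
      using w by simp
    then show False
      using p by (auto simp: in_affine_hull_2_iff)
  qed
  \<comment> \<open>Here \<open>z\<close> is an arbitrary point: the true parallel meets the line
    nowhere, inside or outside \<open>K\<close>.\<close>
  have meet': "\<not> (collinear {p, c', z} \<and> collinear {a, b, z})" for z
  proof
    assume "collinear {p, c', z} \<and> collinear {a, b, z}"
    then obtain u t where "z = p + u *\<^sub>R (c' - p)" "z = a + t *\<^sub>R (b - a)"
      using collinear_3_affine_hull[of p c' z] collinear_3_affine_hull[of a b z] cp neq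
      unfolding in_affine_hull_2_iff by metis
    then have "p = a + (t - u * \<epsilon>) *\<^sub>R (b - a)"
      by (simp add: c'_def algebra_simps)
    then show False
      using p by (auto simp: in_affine_hull_2_iff)
  qed
  have "{a, b, p} \<subseteq> K \<inter> affine hull {a, b, p}"
    using assms by (auto intro: hull_inc)
  then have "collinear {p, c, c'}"
    using PF c c' cp neq nc meet meet' unfolding Playfair_def by blast
  \<comment> \<open>Collinearity would make \<open>q - p\<close> parallel to \<open>b - a\<close>.
    As \<open>q\<close> is on the line through \<open>a\<close> and \<open>b\<close>, so would be
    \<open>p\<close>.\<close>
  then obtain u where "c' = p + u *\<^sub>R (c - p)"
    using collinear_3_affine_hull[of p c c'] cp by (auto simp: in_affine_hull_2_iff)
  then have u: "\<epsilon> *\<^sub>R (b - a) = (u * \<delta>) *\<^sub>R (q - p)"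
    by (simp add: c_def c'_def)
  define w where "w = u * \<delta>"
  have w: "w \<noteq> 0"
    using u \<epsilon> neq by (auto simp: w_def)
  have "w *\<^sub>R p = w *\<^sub>R a + (w * r - \<epsilon>) *\<^sub>R (b - a)"
    using u unfolding w_def[symmetric] r by (simp add: algebra_simps)
  also have "\<dots> = w *\<^sub>R (a + ((w * r - \<epsilon>) / w) *\<^sub>R (b - a))"
    using w by (simp add: scaleR_add_right)
  finally have "p = a + ((w * r - \<epsilon>) / w) *\<^sub>R (b - a)"
    using w by simp
  then show False
    using p by (auto simp: in_affine_hull_2_iff)
qed

section \<open>The three structures\<close>

lemma noncollinear_axes:
  fixes x :: "real ^ 'n"
  assumes "i \<noteq> j" "r \<noteq> 0" "s \<noteq> 0"
  shows "\<not> collinear {x, x + axis i r, x + axis j s}"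
proof -
  have "x + axis j s \<noteq> x + t *\<^sub>R (x + axis i r - x)" for t
  proof
    assume "x + axis j s = x + t *\<^sub>R (x + axis i r - x)"
    then have "axis j s $ j = (t *\<^sub>R axis i r) $ j" by simp
    then show False
      using assms by (simp add: axis_def)
  qed
  moreover have "x \<noteq> x + axis i r"
    using assms by simp
  ultimately show ?thesis
    by (subst collinear_3_affine_hull) (auto simp: in_affine_hull_2_iff)
qed

section \<open>Projective equivalence of slab and half-space\<close>

text \<open>A projective map sends segments to segments where its denominator is positive. The
  denominator is affine in \<open>x\<close>, so positivity at the endpoints suffices.\<close>

lemma perspective_closed_segment:
  fixes a b x :: "real ^ 'n"
  assumes "x \<in> closed_segment a b" "0 < 1 + c * a $ k" "0 < 1 + c * b $ k"
  shows "(1 / (1 + c * x $ k)) *\<^sub>R x \<in>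
    closed_segment ((1 / (1 + c * a $ k)) *\<^sub>R a) ((1 / (1 + c * b $ k)) *\<^sub>R b)"
proof -
  obtain u where u: "0 \<le> u" "u \<le> 1" and x: "x = (1 - u) *\<^sub>R a + u *\<^sub>R b"
    using assms(1) by (auto simp: in_segment)
  define \<alpha> \<beta> \<xi> where defs: "\<alpha> = 1 + c * a $ k" "\<beta> = 1 + c * b $ k" "\<xi> = 1 + c * x $ k"
  have \<xi>: "\<xi> = (1 - u) * \<alpha> + u * \<beta>"
    by (simp add: defs x algebra_simps)
  have pos: "0 < \<alpha>" "0 < \<beta>"
    using assms(2,3) by (auto simp: defs)
  then have "0 < \<xi>"
    unfolding \<xi> using u by (cases "u = 0") (auto intro!: add_nonneg_pos)
  \<comment> \<open>The convex weights of the image are the old weights multiplied by the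
    denominators at the endpoints and normalized by \<open>\<xi>\<close>.\<close>
  define v where "v = u * \<beta> / \<xi>"
  have v: "1 - v = (1 - u) * \<alpha> / \<xi>"
    using \<open>0 < \<xi>\<close> by (simp add: v_def \<xi> field_simps)
  have "0 \<le> v" "0 \<le> 1 - v"
    unfolding v using u pos \<open>0 < \<xi>\<close> by (auto simp: v_def)
  moreover have "(1 / \<xi>) *\<^sub>R x = (1 - v) *\<^sub>R (1 / \<alpha>) *\<^sub>R a + v *\<^sub>R (1 / \<beta>) *\<^sub>R b"
    unfolding v using pos by (simp add: v_def x scaleR_add_right)
  ultimately show ?thesis
    unfolding defs[symmetric] in_segment by (intro exI[of _ v]) auto
qed

text \<open>The parameter -1 transforms the \<open>k\<close>-th coordinate by
  \<open>t / (1 - t)\<close>, which carries the interval from 0 to 1 onto the positive reals; the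
  parameter 1 gives the inverse. Both directions preserve segments, hence betweenness is also
  reflected.\<close>

lemma isomorphic_slab_halfspace:
  "isomorphic (convex_struct (open_slab k)) (convex_struct (open_halfspace k))"
proof -
  define f where "f c x = (1 / (1 + c * x $ k)) *\<^sub>R x" for c and x :: "real ^ 'a"
  have inverse: "f (- c) (f c x) = x" if "0 < 1 + c * x $ k" for c x
  proof -
    \<comment> \<open>The denominator of the second map at the image point is the reciprocal of the
      first denominator, so the two factors cancel.\<close>
    have "1 - c * (x $ k / (1 + c * x $ k)) = 1 / (1 + c * x $ k)"
      using that by (simp add: field_simps)
    then show ?thesis
      using that by (simp add: f_def)
  qed
  have gf: "f 1 (f (- 1) x) = x" if "x \<in> open_slab k" for x
    using inverse[of "- 1" x] that by (simp add: open_slab_def)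
  have fg: "f (- 1) (f 1 x) = x" if "x \<in> open_halfspace k" for x
    using inverse[of 1 x] that by (simp add: open_halfspace_def)
  have f: "f (- 1) x \<in> open_halfspace k" if "x \<in> open_slab k" for x
    using that by (simp add: f_def open_slab_def open_halfspace_def)
  have g: "f 1 x \<in> open_slab k" if "x \<in> open_halfspace k" for x
    using that by (simp add: f_def open_slab_def open_halfspace_def)
  have seg: "f c x \<in> closed_segment (f c a) (f c b)"
    if "x \<in> closed_segment a b" "0 < 1 + c * a $ k" "0 < 1 + c * b $ k" for a b c x
    using perspective_closed_segment[OF that] by (simp add: f_def)
  have "x \<in> closed_segment a b \<longleftrightarrow> f (- 1) x \<in> closed_segment (f (- 1) a) (f (- 1) b)"
    if "a \<in> open_slab k" "x \<in> open_slab k" "b \<in> open_slab k" for a x b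
  proof
    assume "x \<in> closed_segment a b"
    then show "f (- 1) x \<in> closed_segment (f (- 1) a) (f (- 1) b)"
      using that by (intro seg) (auto simp: open_slab_def)
  next
    assume "f (- 1) x \<in> closed_segment (f (- 1) a) (f (- 1) b)"
    then have "f 1 (f (- 1) x) \<in> closed_segment (f 1 (f (- 1) a)) (f 1 (f (- 1) b))"
      using seg[of "f (- 1) x" "f (- 1) a" "f (- 1) b" 1] f[OF that(1)] f[OF that(3)]
      by (simp add: open_halfspace_def)
    then show "x \<in> closed_segment a b"
      using that by (simp add: gf)
  qed
  moreover have "bij_betw (f (- 1)) (open_slab k) (open_halfspace k)"
    by (rule bij_betw_byWitness[where f' = "f 1"]) (auto simp: gf fg f g)
  ultimately show ?thesis
    unfolding isomorphic_def convex_struct_def by (intro exI[of _ "f (- 1)"]) auto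
qed

section \<open>The two sentences in the space, the slab and the ball\<close>

lemma affine_line_not_subset_bounded:
  fixes a b :: "'a::euclidean_space"
  assumes "bounded K" "a \<noteq> b"
  shows "\<not> affine hull {a, b} \<subseteq> K"
proof
  assume "affine hull {a, b} \<subseteq> K"
  then have "bounded (affine hull {a, b})"
    using assms(1) bounded_subset by blast
  then obtain c where "affine hull {a, b} = {c}"
    using affine_bounded_eq_trivial[of "affine hull {a, b}"] by auto
  then show False
    using assms(2) hull_subset[of "{a, b}" affine] by auto
qed

lemma open_slab_halfspaces: "open_slab k = {x. axis k 1 \<bullet> x > 0} \<inter> {x. axis k 1 \<bullet> x < 1}"
  by (auto simp: open_slab_def inner_axis')

lemma models_And: "S \<Turnstile> And \<phi> \<psi> \<longleftrightarrow> S \<Turnstile> \<phi> \<and> S \<Turnstile> \<psi>"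
  by (auto simp: models_def)

lemma models_Psi_UNIV:
  assumes "CARD('n::finite) \<ge> 2"
  shows "convex_struct (UNIV :: (real ^ 'n) set) \<Turnstile> And Psi_all Psi_ex"
proof -
  obtain i j :: 'n where "i \<noteq> j"
    using assms by (metis card_2_iff' ex_card subsetI UNIV_I)
  then have "\<not> collinear {0, 0 + axis i 1, 0 + axis j (1 :: real)}"
    by (intro noncollinear_axes) auto
  then show ?thesis
    by (auto simp: models_def sat_Psi_all sat_Psi_ex fst_convex_struct Playfair_affine_plane)
qed

lemma models_Psi_slab:
  fixes k :: "'n::finite"
  assumes "CARD('n) \<ge> 3"
  shows "convex_struct (open_slab k) \<Turnstile> And (Neg Psi_all) Psi_ex"
proof -
  \<comment> \<open>Dimension at least 3 leaves two axes \<open>i\<close>, \<open>j\<close> besides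
    \<open>k\<close>; they span a plane parallel to the boundary.\<close>
  have "card (UNIV - {k}) \<ge> 2"
    using assms by (simp add: card_Diff_singleton)
  then obtain T where "T \<subseteq> UNIV - {k}" "card T = 2"
    by (metis ex_card)
  then obtain i j where ij: "i \<noteq> j" "i \<noteq> k" "j \<noteq> k"
    by (auto simp: card_2_iff)
  have conv: "convex (open_slab k)"
    unfolding open_slab_halfspaces by (intro convex_Int convex_halfspace_lt convex_halfspace_gt)
  have opn: "open (open_slab k)"
    unfolding open_slab_halfspaces by (intro open_Int open_halfspace_lt open_halfspace_gt)
  \<comment> \<open>The heights are 1/2 for \<open>?a\<close>, \<open>?p\<close>, \<open>?q\<close>
    and 3/4 for \<open>?b\<close>. The line through \<open>?a\<close> and \<open>?b\<close> is
    orthogonal to the boundary; at parameter 4 it has height 3/2 and has left the slab.\<close>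
  let ?a = "axis k (1 / 2) :: real ^ 'n"
  let ?b = "?a + axis k (1 / 4)" and ?p = "?a + axis i 1" and ?q = "?a + axis j 1"
  have in_slab: "?a \<in> open_slab k" "?b \<in> open_slab k" "?p \<in> open_slab k" "?q \<in> open_slab k"
    using ij by (auto simp: open_slab_def axis_def)
  have "?a + 4 *\<^sub>R (?b - ?a) \<in> affine hull {?a, ?b}"
    unfolding in_affine_hull_2_iff by blast
  moreover have "?a + 4 *\<^sub>R (?b - ?a) \<notin> open_slab k"
    by (simp add: open_slab_def axis_def)
  moreover have abp: "\<not> collinear {?a, ?b, ?p}"
    using ij by (intro noncollinear_axes) auto
  ultimately have not_all: "\<not> Playfair (open_slab k \<inter> affine hull {?a, ?b, ?p})"
    using in_slab by (intro not_Playfair_section opn) auto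
  have apq: "\<not> collinear {?a, ?p, ?q}"
    using ij by (intro noncollinear_axes) auto
  \<comment> \<open>Both spanning directions have \<open>k\<close>-th coordinate 0, so the plane
    stays at height 1/2.\<close>
  have "affine hull {?a, ?p, ?q} \<subseteq> open_slab k"
    using ij by (auto simp: in_affine_hull_3_iff open_slab_def axis_def)
  then have "open_slab k \<inter> affine hull {?a, ?p, ?q} = affine hull {?a, ?p, ?q}"
    by blast
  then have ex: "Playfair (open_slab k \<inter> affine hull {?a, ?p, ?q})"
    by (simp add: Playfair_affine_plane)
  show ?thesis
    using sat_Psi_all[OF conv] sat_Psi_ex[OF conv] in_slab abp not_all apq ex
    unfolding models_def fst_convex_struct sat.simps by blast
qed

text \<open>Lines are unbounded, so for any noncollinear triple the line through the first two
  points leaves the ball, and every planar section violates Playfair.\<close>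

lemma models_Psi_ball:
  assumes "CARD('n::finite) \<ge> 2"
  shows "convex_struct (ball (0 :: real ^ 'n) 1) \<Turnstile> And (Neg Psi_all) (Neg Psi_ex)"
proof -
  let ?B = "ball (0 :: real ^ 'n) 1"
  have no: "\<not> Playfair (?B \<inter> affine hull {p1, p2, p3})"
    if "p1 \<in> ?B" "p2 \<in> ?B" "p3 \<in> ?B" "\<not> collinear {p1, p2, p3}" for p1 p2 p3
  proof (rule not_Playfair_section)
    have "p1 \<noteq> p2"
      using that(4) by auto
    then show "\<not> affine hull {p1, p2} \<subseteq> ?B"
      by (intro affine_line_not_subset_bounded) auto
  qed (use that in auto)
  \<comment> \<open>Refuting \<open>Psi_all\<close> takes an actual noncollinear triple in the ball;
    steps of length 1/2 along two axes stay inside.\<close>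
  obtain i j :: 'n where "i \<noteq> j"
    using assms by (metis card_2_iff' ex_card subsetI UNIV_I)
  then have nc: "\<not> collinear {0, 0 + axis i (1 / 2), 0 + axis j (1 / 2 :: real)}"
    by (intro noncollinear_axes) auto
  have "norm (axis m (1 / 2 :: real)) < 1" for m :: 'n
    by (simp add: norm_eq_sqrt_inner inner_axis_axis real_sqrt_divide)
  then have in_B: "0 \<in> ?B" "0 + axis i (1 / 2) \<in> ?B" "0 + axis j (1 / 2) \<in> ?B"
    by auto
  show ?thesis
    unfolding models_def fst_convex_struct sat.simps
  proof (intro allI impI conjI)
    fix e :: "nat \<Rightarrow> real ^ 'n" assume e: "range e \<subseteq> ?B"
    show "\<not> sat (convex_struct ?B) e Psi_all"
      unfolding sat_Psi_all[OF convex_ball e] using no[OF in_B nc] in_B nc by blast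
    show "\<not> sat (convex_struct ?B) e Psi_ex"
      unfolding sat_Psi_ex[OF convex_ball e] using no by blast
  qed
qed

theorem proposition10p6:
  fixes k :: "'n::finite"
  assumes "CARD('n) \<ge> 3"
  shows "(convex_struct (UNIV :: (real ^ 'n) set) \<Turnstile> And Psi_all Psi_ex) \<and>
         (convex_struct (open_slab k) \<Turnstile> And (Neg Psi_all) Psi_ex) \<and>
         (convex_struct (ball (0 :: real ^ 'n) 1) \<Turnstile> And (Neg Psi_all) (Neg Psi_ex)) \<and>
         isomorphic (convex_struct (open_slab k)) (convex_struct (open_halfspace k)) \<and>
         \<not> elem_equiv (convex_struct (UNIV :: (real ^ 'n) set)) (convex_struct (open_slab k)) \<and>
         \<not> elem_equiv (convex_struct (open_slab k)) (convex_struct (ball (0 :: real ^ 'n) 1)) \<and>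
         \<not> elem_equiv (convex_struct (UNIV :: (real ^ 'n) set)) (convex_struct (ball (0 :: real ^ 'n) 1)) \<and>
         \<not> elem_equiv (convex_struct (UNIV :: (real ^ 'n) set)) (convex_struct (open_halfspace k)) \<and>
         \<not> elem_equiv (convex_struct (open_halfspace k)) (convex_struct (ball (0 :: real ^ 'n) 1))"
proof -
  let ?U = "convex_struct (UNIV :: (real ^ 'n) set)" and ?S = "convex_struct (open_slab k)"
    and ?B = "convex_struct (ball (0 :: real ^ 'n) 1)" and ?H = "convex_struct (open_halfspace k)"
  have U: "?U \<Turnstile> And Psi_all Psi_ex" and B: "?B \<Turnstile> And (Neg Psi_all) (Neg Psi_ex)"
    using assms by (auto intro: models_Psi_UNIV models_Psi_ball)
  have S: "?S \<Turnstile> And (Neg Psi_all) Psi_ex"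
    using assms by (rule models_Psi_slab)
  have iso: "isomorphic ?S ?H"
    by (rule isomorphic_slab_halfspace)
  have H: "?H \<Turnstile> And (Neg Psi_all) Psi_ex"
    using S isomorphic_imp_models_iff[OF iso] by blast
  have "axis k (1 / 2) \<in> open_slab k" "axis k (1 / 2) \<in> open_halfspace k"
    by (auto simp: open_slab_def open_halfspace_def)
  then have nonempty: "fst ?S \<noteq> {}" "fst ?H \<noteq> {}" "fst ?B \<noteq> {}"
    by (auto simp: fst_convex_struct)
  \<comment> \<open>\<open>Psi_all\<close> separates the whole space from the other structures, and
    \<open>Psi_ex\<close> separates the ball from the slab, the half-space and the whole
    space.\<close>
  have "\<not> elem_equiv ?U T" if "T \<Turnstile> Neg Psi_all" "fst T \<noteq> {}" for T :: "(real ^ 'n) bstruct"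
    using U that by (intro not_elem_equivI[OF sentence_Psi(1)]) (auto simp: models_And)
  moreover have "\<not> elem_equiv T ?B" if "T \<Turnstile> Psi_ex" for T :: "(real ^ 'n) bstruct"
    using B that nonempty(3) by (intro not_elem_equivI[OF sentence_Psi(2)]) (auto simp: models_And)
  ultimately show ?thesis
    using U S B H iso nonempty by (simp add: models_And)
qed

end
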